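(* Let $\alpha\in(0,1)$ and let $0<\delta<\alpha(1-\alpha)/4$. For each $n$ let $(x_i,y_i)_{i=1}^n$ be independent copies of $(x,y)$ with $y=f(x)+\epsilon$, where $x$ takes values in $\mathscr X$, $\mathbb E[f(x)]=0$, $\mathbb E[f^2(x)]=\sigma_\mu^2$, $\mathbb E[f^4(x)]<\infty$, $\mathbb E(\epsilon)=0$, $\mathbb E(\epsilon^2)=\sigma_\epsilon^2$, and $\epsilon$ is independent of $x$. Assume moreover that $\mathrm{Var}(f^2(x))\le\kappa\,\sigma_\mu^4$ for some constant $\kappa>0$. Suppose there are an estimator $\hat f:\mathscr X\times(\mathscr X\times\mathbb R)^n\times\Pi_n\to\mathbb R$ and a sequence $\ell_n$ (possibly depending on $\delta$) such that (i) for all $\pi\in\Pi_n$, $\hat f(x_i;(x_j,y_j)_{j=1}^n;\pi)=\hat f(x_i;(x_j,y_{\pi(j)})_{j=1}^n;\pi_0)$; (ii) for all $n$ sufficiently large, $\min_{\pi\in\tilde\Pi_n\cup\{\pi_0\}}\mathbb P\big\{\sum_{i=1}^n[\hat f(x_i;(x_j,y_j)_{j=1}^n;\pi)-f_\pi(x_i)]^2\le\ell_n\big\}\ge1-\delta$. If $h>0$ is sufficiently large (not depending on $n$), then under the alternative $$H_1:\ f\not\equiv0,\quad f\in\mathscr F,\quad \sigma_\mu^2=h\,\frac{\ell_n}{n},$$ one has $$\liminf_{n\to\infty}\mathbb P_{H_1}(\phi(\hat f)\le\alpha)>\alpha.$$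
   Context: $\mathscr F$ is a prespecified class of functions on $\mathscr X$; the model (in particular $f$) may vary with $n$, while $\kappa$ does not. $\Pi_n$ is the set of all permutations of $[n]=\{1,\dots,n\}$, $\pi_0$ is the identity permutation, $K(\pi)$ is the number of cycles of $\pi$ (fixed points count as cycles), and $\tilde\Pi_n=\{\pi\in\Pi_n:K(\pi)\le\log^2(n)\}$. For $\pi\in\Pi_n$, $f_\pi(x_i):=\mathbb E(y_{\pi(i)}\mid x_i)$ (so $f_\pi(x_i)=f(x_i)$ if $\pi(i)=i$ and $f_\pi(x_i)=0$ otherwise). Set $\hat f_\pi(\cdot)=\hat f(\cdot;(x_j,y_j)_{j=1}^n;\pi)$ and $\Lambda^{(\pi)}(\hat f)=\sum_{i=1}^n[\hat f_\pi(x_i)]^2$. The permutation p-value is $\phi(\hat f)=\frac1{|\Pi_n|}\sum_{\pi\in\Pi_n}\mathbf 1\{\Lambda^{(\pi_0)}(\hat f)\le\Lambda^{(\pi)}(\hat f)\}$. "$h$ sufficiently large (not depending on $n$)" means: there is a threshold $h_0$ not depending on $n$ such that the conclusion holds for every fixed $h\ge h_0$. *)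

theory Defs
  imports "HOL-Probability.Probability" "HOL-Combinatorics.Orbits"
begin

definition perms :: "nat \<Rightarrow> (nat \<Rightarrow> nat) set" where
  "perms n = {\<pi>. \<pi> permutes {1..n}}"

(* For a permutation, orbit \<pi> i is the cycle through i; a fixed point gives {i}. *)
definition num_cycles :: "nat \<Rightarrow> (nat \<Rightarrow> nat) \<Rightarrow> nat" where
  "num_cycles n \<pi> = card (orbit \<pi> ` {1..n})"

definition few_cycle_perms :: "nat \<Rightarrow> (nat \<Rightarrow> nat) set" where
  "few_cycle_perms n = {\<pi> \<in> perms n. real (num_cycles n \<pi>) \<le> (ln (real n))\<^sup>2}"

(* An n-tuple of data points is a function on {1..n}, extended by undefined. *)
definition sample :: "nat \<Rightarrow> (nat \<Rightarrow> 'a) \<Rightarrow> (nat \<Rightarrow> real) \<Rightarrow> nat \<Rightarrow> 'a \<times> real" where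
  "sample n x y = (\<lambda>j\<in>{1..n}. (x j, y j))"

(* For sample size n: the evaluation point, the n data points, and the permutation. *)
type_synonym 'a estimator =
  "nat \<Rightarrow> 'a \<Rightarrow> (nat \<Rightarrow> 'a \<times> real) \<Rightarrow> (nat \<Rightarrow> nat) \<Rightarrow> real"

definition measurable_estimator :: "'a measure \<Rightarrow> 'a estimator \<Rightarrow> bool" where
  "measurable_estimator S fhat \<longleftrightarrow>
    (\<forall>n. \<forall>\<pi>\<in>perms n.
      (\<lambda>(u, d). fhat n u d \<pi>) \<in> borel_measurable (S \<Otimes>\<^sub>M (\<Pi>\<^sub>M j\<in>{1..n}. S \<Otimes>\<^sub>M borel)))"

definition test_stat ::
  "'a estimator \<Rightarrow> nat \<Rightarrow> (nat \<Rightarrow> 'a) \<Rightarrow> (nat \<Rightarrow> real) \<Rightarrow> (nat \<Rightarrow> nat) \<Rightarrow> real" where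
  "test_stat fhat n x y \<pi> = (\<Sum>i=1..n. (fhat n (x i) (sample n x y) \<pi>)\<^sup>2)"

definition perm_pvalue ::
  "'a estimator \<Rightarrow> nat \<Rightarrow> (nat \<Rightarrow> 'a) \<Rightarrow> (nat \<Rightarrow> real) \<Rightarrow> real" where
  "perm_pvalue fhat n x y =
    (\<Sum>\<pi>\<in>perms n. of_bool (test_stat fhat n x y id \<le> test_stat fhat n x y \<pi>))
      / real (card (perms n))"

(* A version of E(y_{\<pi>(i)} | x_i), as a random variable on M. *)
definition f_perm ::
  "'w measure \<Rightarrow> 'a measure \<Rightarrow> (nat \<Rightarrow> 'w \<Rightarrow> 'a) \<Rightarrow> (nat \<Rightarrow> 'w \<Rightarrow> real) \<Rightarrow> (nat \<Rightarrow> nat) \<Rightarrow>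
    nat \<Rightarrow> 'w \<Rightarrow> real" where
  "f_perm M S x y \<pi> i =
    real_cond_exp M (vimage_algebra (space M) (x i) S) (y (\<pi> i))"

(* x0, eps are the generic covariate and noise; (x i, y i), 1 \<le> i \<le> n, are the observations.
   Integrability of f(x0) and its square follows from that of its fourth power, and
   integrability of eps from that of its square. Independence is stated via the generated
   sigma-algebras because indep_var needs both variables to have the same value type. *)
locale regression_sample = prob_space M
  for M :: "'w measure" and S :: "'a measure" and n :: nat and f :: "'a \<Rightarrow> real"
    and x0 :: "'w \<Rightarrow> 'a" and eps :: "'w \<Rightarrow> real"
    and x :: "nat \<Rightarrow> 'w \<Rightarrow> 'a" and y :: "nat \<Rightarrow> 'w \<Rightarrow> real"
    and \<sigma>\<^sub>\<mu> \<sigma>\<^sub>\<epsilon> \<kappa> :: real +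
  assumes f_measurable: "f \<in> borel_measurable S"
    and x0_measurable: "random_variable S x0"
    and eps_measurable: "random_variable borel eps"
    and noise_indep: "indep_set (sets (vimage_algebra (space M) x0 S))
                                (sets (vimage_algebra (space M) eps borel))"
    and signal_fourth: "integrable M (\<lambda>\<omega>. f (x0 \<omega>) ^ 4)"
    and signal_mean: "expectation (\<lambda>\<omega>. f (x0 \<omega>)) = 0"
    and signal_second: "expectation (\<lambda>\<omega>. (f (x0 \<omega>))\<^sup>2) = \<sigma>\<^sub>\<mu>\<^sup>2"
    and signal_var: "variance (\<lambda>\<omega>. (f (x0 \<omega>))\<^sup>2) \<le> \<kappa> * \<sigma>\<^sub>\<mu> ^ 4"
    and noise_integrable: "integrable M (\<lambda>\<omega>. (eps \<omega>)\<^sup>2)"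
    and noise_mean: "expectation eps = 0"
    and noise_second: "expectation (\<lambda>\<omega>. (eps \<omega>)\<^sup>2) = \<sigma>\<^sub>\<epsilon>\<^sup>2"
    and sample_indep: "indep_vars (\<lambda>_. S \<Otimes>\<^sub>M borel) (\<lambda>i \<omega>. (x i \<omega>, y i \<omega>)) {1..n}"
    and sample_distr: "\<And>i. i \<in> {1..n} \<Longrightarrow>
      distr M (S \<Otimes>\<^sub>M borel) (\<lambda>\<omega>. (x i \<omega>, y i \<omega>)) =
      distr M (S \<Otimes>\<^sub>M borel) (\<lambda>\<omega>. (x0 \<omega>, f (x0 \<omega>) + eps \<omega>))"

(* "f is not identically 0" is read modulo null sets of the law of x0, i.e. in L^2. Reading it
   pointwise would admit \<sigma>\<^sub>\<mu> = \<ell> = 0 (f nonzero only on a null set), where the estimator 0 makes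
   every test statistic vanish and the test has no power. *)
definition alternative ::
  "('a \<Rightarrow> real) set \<Rightarrow> real \<Rightarrow> real \<Rightarrow> nat \<Rightarrow> 'w measure \<Rightarrow> ('a \<Rightarrow> real) \<Rightarrow> ('w \<Rightarrow> 'a) \<Rightarrow> real \<Rightarrow> bool"
  where
  "alternative \<F> h \<l> n M f x0 \<sigma>\<^sub>\<mu> \<longleftrightarrow>
    \<not> (AE \<omega> in M. f (x0 \<omega>) = 0) \<and> f \<in> \<F> \<and> \<sigma>\<^sub>\<mu>\<^sup>2 = h * \<l> / real n"

end

theory Submission
  imports Defs "HOL-Real_Asymp.Real_Asymp"
begin

text \<open>
The test compares the squared length of the vector of fitted values on the data with its
counterpart for permuted responses. For permuted responses the best predictor is zero except at
the fixed points of the permutation (lemma \<open>f_perm_AE\<close>). A permutation with at most \<open>(ln n)\<^sup>2\<close>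
cycles has at most \<open>(ln n)\<^sup>2\<close> fixed points, and the signal energy on so few points is of order
\<open>h * \<l> n * (ln n)\<^sup>2 / n\<close>, negligible against the accuracy \<open>\<l> n\<close> of the estimator; the fitted vector
is then shorter than \<open>2 * sqrt (\<l> n)\<close>. On the data themselves the energy of the signal
concentrates around \<open>h * \<l> n\<close> (lemma \<open>prob_signal_energy_small\<close>), so for \<open>h \<ge> 18\<close> the fitted vector
is at least that long. Up to events of vanishing probability, the permuted statistic can therefore
reach the original one only if one of the two fits is inaccurate, which has probability at most
\<open>2 * \<delta>\<close> (lemma \<open>prob_exceed_event_le\<close>).

Almost all permutations have at most \<open>(ln n)\<^sup>2\<close> cycles, since the average number of cycles is
at most \<open>ln n + 1\<close> (lemma \<open>card_many_cycle_perms_le\<close>). Averaging over permutations, the p-value has mean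
at most \<open>2 * \<delta> + o(1)\<close>. By Markov's inequality it exceeds \<open>\<alpha>\<close> with probability at most
\<open>(2 * \<delta> + o(1)) / \<alpha>\<close> (lemma \<open>pvalue_tail_bound\<close>). As \<open>2 * \<delta> / \<alpha> < (1 - \<alpha>) / 2\<close>, the power is
eventually at least \<open>(1 + \<alpha>) / 2\<close>, which is larger than \<open>\<alpha>\<close>.
\<close>

section \<open>Cycles of random permutations\<close>

lemma orbit_eq_if_mem:
  assumes "permutation p" "y \<in> orbit p x"
  shows "orbit p y = orbit p x"
  using orbit_cyclic_eq3[OF cyclic_on_orbit'[OF assms(1)] assms(2)] .

text \<open>Composing with the transposition inserts \<open>a\<close> into the cycle of \<open>p\<close> through \<open>b\<close>, immediately
before \<open>b\<close>. All old cycles survive and the new point starts none of its own. For the inequality it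
suffices that every cycle of \<open>p\<close> lies inside a cycle of the new permutation, so that mapping an old
cycle to the new cycle around it is onto.\<close>

lemma card_orbits_transpose_comp_le:
  assumes "p permutes A" "finite A" "a \<notin> A" "b \<in> A"
  shows "card (orbit (Transposition.transpose a b \<circ> p) ` insert a A) \<le> card (orbit p ` A)"
proof -
  define q where "q = Transposition.transpose a b \<circ> p"
  have q: "q permutes insert a A"
    using permutes_insert[of a A] assms unfolding q_def by auto
  have perm: "permutation p" "permutation q"
    using assms q by (auto simp: permutation_permutes)
  have pa: "p a = a" using assms(1,3) by (simp add: permutes_not_in)
  have step: "p z \<in> orbit q z" if "z \<in> A" for z
  proof (cases "p z = b")
    case True
    then have "q z = a" "q a = p z" using pa by (auto simp: q_def)
    then show ?thesis by (metis orbit.base orbit.step)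
  next
    case False
    have "p z \<in> A" using that assms(1) by (simp add: permutes_in_image)
    with assms(3) have "p z \<noteq> a" by auto
    with False have "q z = p z" by (simp add: q_def transpose_apply_other)
    then show ?thesis by (metis orbit.base)
  qed
  have refine: "orbit p z \<subseteq> orbit q z" if "z \<in> A" for z
  proof
    fix w assume "w \<in> orbit p z"
    then show "w \<in> orbit q z"
    proof induction
      case base then show ?case using step that by simp
    next
      case (step w)
      have "w \<in> A" using step.hyps permutes_orbit_subset[OF assms(1) that] by auto
      from \<open>\<And>z. z \<in> A \<Longrightarrow> p z \<in> orbit q z\<close>[OF this] step.IH show ?case
        by (rule orbit_trans)
    qed
  qed
  have "orbit q a = orbit q b"
    using orbit_eq_if_mem[OF perm(2), of b a] pa by (metis comp_apply orbit.base q_def transpose_apply_first)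
  then have img: "orbit q ` insert a A = orbit q ` A"
    using assms(4) by auto
  have "orbit q ` A \<subseteq> (\<lambda>C. orbit q (SOME z. z \<in> C)) ` orbit p ` A"
  proof
    fix C assume "C \<in> orbit q ` A"
    then obtain z where z: "z \<in> A" "C = orbit q z" by auto
    have "(SOME w. w \<in> orbit p z) \<in> orbit p z"
      using permutation_self_in_orbit[OF perm(1)] by (rule someI)
    then have "(SOME w. w \<in> orbit p z) \<in> orbit q z" using refine z by auto
    then have "C = orbit q (SOME w. w \<in> orbit p z)"
      using orbit_eq_if_mem[OF perm(2)] z by simp
    then show "C \<in> (\<lambda>C. orbit q (SOME z. z \<in> C)) ` orbit p ` A" using z by auto
  qed
  then have "card (orbit q ` A) \<le> card (orbit p ` A)"
    using assms(2) by (intro surj_card_le) auto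
  with img show ?thesis by (simp add: q_def)
qed

lemma finite_perms [simp]: "finite (perms n)"
  by (simp add: perms_def finite_permutations)

lemma card_perms [simp]: "card (perms n) = fact n"
  unfolding perms_def by (rule card_permutations) auto

text \<open>A uniformly random permutation of \<open>n\<close> points has harmonically many cycles on average. Every
permutation of \<open>n + 1\<close> points is a permutation of \<open>n\<close> points composed with a transposition of the
new point and some \<open>b\<close>. Only the choice of \<open>b\<close> equal to the new point, one in \<open>n + 1\<close>, creates a
new cycle, so the average grows by at most \<open>1 / (n + 1)\<close>.\<close>

lemma sum_num_cycles_le:
  "real (\<Sum>\<pi>\<in>perms n. num_cycles n \<pi>) \<le> fact n * harm n"
proof (induction n)
  case 0
  then show ?case by (simp add: num_cycles_def harm_def)
next
  case (Suc n)
  let ?a = "Suc n" and ?S = "{1..n}"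
  have S: "{1..Suc n} = insert ?a ?S" by auto
  have rep: "perms (Suc n) = (\<lambda>(b, p). Transposition.transpose ?a b \<circ> p) ` (insert ?a ?S \<times> perms n)"
    unfolding perms_def S permutes_insert by (rule arg_cong2[where f=image]) auto
  have new: "num_cycles (Suc n) (Transposition.transpose ?a ?a \<circ> p) \<le> num_cycles n p + 1" if "p \<in> perms n" for p
    unfolding num_cycles_def S by (simp add: card_insert_le_m1 card_insert_if)
  have old: "num_cycles (Suc n) (Transposition.transpose ?a b \<circ> p) \<le> num_cycles n p"
    if "p \<in> perms n" "b \<in> ?S" for p b
    unfolding num_cycles_def S using that
    by (intro card_orbits_transpose_comp_le) (auto simp: perms_def)
  have "(\<Sum>\<pi>\<in>perms (Suc n). num_cycles (Suc n) \<pi>)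
      \<le> (\<Sum>(b, p)\<in>insert ?a ?S \<times> perms n. num_cycles (Suc n) (Transposition.transpose ?a b \<circ> p))"
    unfolding rep by (rule order_trans[OF sum_image_le]) (auto simp: case_prod_unfold)
  also have "\<dots> = (\<Sum>b\<in>insert ?a ?S. \<Sum>p\<in>perms n. num_cycles (Suc n) (Transposition.transpose ?a b \<circ> p))"
    by (simp add: sum.cartesian_product)
  also have "\<dots> = (\<Sum>p\<in>perms n. num_cycles (Suc n) (Transposition.transpose ?a ?a \<circ> p))
      + (\<Sum>b\<in>?S. \<Sum>p\<in>perms n. num_cycles (Suc n) (Transposition.transpose ?a b \<circ> p))"
    by (subst sum.insert) auto
  also have "\<dots> \<le> (\<Sum>p\<in>perms n. num_cycles n p + 1) + (\<Sum>b\<in>?S. \<Sum>p\<in>perms n. num_cycles n p)"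
    using new old by (intro add_mono sum_mono) auto
  also have "\<dots> = Suc n * (\<Sum>p\<in>perms n. num_cycles n p) + fact n"
    by (simp only: sum.distrib) simp
  finally have "real (\<Sum>\<pi>\<in>perms (Suc n). num_cycles (Suc n) \<pi>)
      \<le> real (Suc n * (\<Sum>p\<in>perms n. num_cycles n p) + fact n)"
    by (simp only: of_nat_le_iff)
  also have "\<dots> = real (Suc n) * real (\<Sum>p\<in>perms n. num_cycles n p) + fact n"
    by (simp add: algebra_simps)
  also have "\<dots> \<le> real (Suc n) * (fact n * harm n) + fact n"
    using Suc by (intro add_mono mult_left_mono) auto
  also have "\<dots> = fact (Suc n) * harm (Suc n)"
    by (simp add: harm_Suc field_simps)
  finally show ?case .
qed

lemma harm_le_ln_plus_1: "0 < n \<Longrightarrow> harm n \<le> ln (real n) + 1"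
  using euler_mascheroni_sequence_decreasing[of 1 n] by (simp add: harm_expand)

text \<open>Markov's inequality for the number of cycles: the average is at most \<open>ln n + 1\<close> and the
threshold is \<open>(ln n)\<^sup>2\<close>, so the exceptional permutations have vanishing proportion.\<close>

lemma card_many_cycle_perms_le:
  assumes "2 \<le> n"
  shows "real (card (perms n - few_cycle_perms n)) \<le> fact n * ((ln (real n) + 1) / (ln (real n))\<^sup>2)"
proof -
  have ln: "0 < ln (real n)" using assms by simp
  have "real (card (perms n - few_cycle_perms n)) * (ln (real n))\<^sup>2
      = (\<Sum>\<pi>\<in>perms n - few_cycle_perms n. (ln (real n))\<^sup>2)" by simp
  also have "\<dots> \<le> (\<Sum>\<pi>\<in>perms n - few_cycle_perms n. real (num_cycles n \<pi>))"
    by (rule sum_mono) (auto simp: few_cycle_perms_def)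
  also have "\<dots> \<le> (\<Sum>\<pi>\<in>perms n. real (num_cycles n \<pi>))"
    by (rule sum_mono2) auto
  also have "\<dots> \<le> fact n * harm n"
    using sum_num_cycles_le[of n] by simp
  also have "\<dots> \<le> fact n * (ln (real n) + 1)"
    using harm_le_ln_plus_1[of n] assms by (intro mult_left_mono) auto
  finally show ?thesis using ln by (simp add: field_simps)
qed

lemma card_fixed_points_le_num_cycles:
  "card {i \<in> {1..n}. \<pi> i = i} \<le> num_cycles n \<pi>"
proof -
  have "card {i \<in> {1..n}. \<pi> i = i} = card (orbit \<pi> ` {i \<in> {1..n}. \<pi> i = i})"
    by (rule card_image[symmetric], rule inj_onI) (auto simp flip: orbit_eq_singleton_iff)
  also have "\<dots> \<le> num_cycles n \<pi>"
    unfolding num_cycles_def by (intro card_mono) auto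
  finally show ?thesis .
qed

section \<open>Sums of independent centred variables\<close>

lemma (in prob_space) expectation_mult_indep_vars:
  fixes W :: "'i \<Rightarrow> 'a \<Rightarrow> real"
  assumes "indep_vars (\<lambda>_. borel) W {i, j}" "i \<noteq> j"
    and "integrable M (W i)" "integrable M (W j)"
  shows "integrable M (\<lambda>\<omega>. W i \<omega> * W j \<omega>)"
    and "expectation (\<lambda>\<omega>. W i \<omega> * W j \<omega>) = expectation (W i) * expectation (W j)"
  using indep_vars_integrable[OF _ assms(1)] indep_vars_lebesgue_integral[OF _ assms(1)] assms(2-)
  by auto

text \<open>Additivity of the variance, for centred variables: the cross terms vanish by independence.\<close>

lemma (in prob_space) second_moment_sum_indep:
  fixes W :: "'i \<Rightarrow> 'a \<Rightarrow> real"
  assumes "finite I" "indep_vars (\<lambda>_. borel) W I"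
    and sq: "\<And>i. i \<in> I \<Longrightarrow> integrable M (\<lambda>\<omega>. (W i \<omega>)\<^sup>2)"
    and mean: "\<And>i. i \<in> I \<Longrightarrow> expectation (W i) = 0"
  shows "integrable M (\<lambda>\<omega>. (\<Sum>i\<in>I. W i \<omega>)\<^sup>2)"
    and "expectation (\<lambda>\<omega>. (\<Sum>i\<in>I. W i \<omega>)\<^sup>2) = (\<Sum>i\<in>I. expectation (\<lambda>\<omega>. (W i \<omega>)\<^sup>2))"
proof -
  have rv: "W i \<in> borel_measurable M" if "i \<in> I" for i
    using assms(2) that by (auto simp: indep_vars_def)
  have int1: "integrable M (W i)" if "i \<in> I" for i
    using square_integrable_imp_integrable[OF rv sq] that by auto
  have int: "integrable M (\<lambda>\<omega>. W i \<omega> * W j \<omega>)" if "i \<in> I" "j \<in> I" for i j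
  proof (cases "i = j")
    case True then show ?thesis using sq that by (simp add: power2_eq_square)
  next
    case False
    then show ?thesis
      using expectation_mult_indep_vars(1)[OF indep_vars_subset[OF assms(2)]] that int1 by auto
  qed
  have zero: "expectation (\<lambda>\<omega>. W i \<omega> * W j \<omega>) = (if i = j then expectation (\<lambda>\<omega>. (W i \<omega>)\<^sup>2) else 0)"
    if "i \<in> I" "j \<in> I" for i j
    using expectation_mult_indep_vars(2)[OF indep_vars_subset[OF assms(2)], of i j] that int1 mean
    by (auto simp: power2_eq_square)
  have eq: "(\<Sum>i\<in>I. W i \<omega>)\<^sup>2 = (\<Sum>i\<in>I. \<Sum>j\<in>I. W i \<omega> * W j \<omega>)" for \<omega>
    by (simp add: power2_eq_square sum_product)
  show "integrable M (\<lambda>\<omega>. (\<Sum>i\<in>I. W i \<omega>)\<^sup>2)"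
    unfolding eq using int by (intro Bochner_Integration.integrable_sum) auto
  have "expectation (\<lambda>\<omega>. (\<Sum>i\<in>I. W i \<omega>)\<^sup>2) = (\<Sum>i\<in>I. \<Sum>j\<in>I. expectation (\<lambda>\<omega>. W i \<omega> * W j \<omega>))"
    unfolding eq using int by (simp add: Bochner_Integration.integral_sum)
  also have "\<dots> = (\<Sum>i\<in>I. expectation (\<lambda>\<omega>. (W i \<omega>)\<^sup>2))"
    using assms(1) zero by (simp add: sum.delta)
  finally show "expectation (\<lambda>\<omega>. (\<Sum>i\<in>I. W i \<omega>)\<^sup>2) = (\<Sum>i\<in>I. expectation (\<lambda>\<omega>. (W i \<omega>)\<^sup>2))" .
qed

section \<open>Moments and conditional means in the regression model\<close>

context regression_sample
begin

lemma observation_measurable: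
  "i \<in> {1..n} \<Longrightarrow> (\<lambda>\<omega>. (x i \<omega>, y i \<omega>)) \<in> M \<rightarrow>\<^sub>M S \<Otimes>\<^sub>M borel"
  using sample_indep by (auto simp: indep_vars_def)

lemma x_measurable: "i \<in> {1..n} \<Longrightarrow> x i \<in> M \<rightarrow>\<^sub>M S"
  using measurable_comp[OF observation_measurable measurable_fst] by (simp add: comp_def)

lemma generic_observation_measurable:
  "(\<lambda>\<omega>. (x0 \<omega>, f (x0 \<omega>) + eps \<omega>)) \<in> M \<rightarrow>\<^sub>M S \<Otimes>\<^sub>M borel"
  using f_measurable x0_measurable eps_measurable by measurable

text \<open>Transfers moments from the generic observation, where signal and noise are separate, to each
observation of the sample.\<close>

lemma observation_integral:
  fixes g :: "'a \<times> real \<Rightarrow> real"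
  assumes "i \<in> {1..n}" "g \<in> borel_measurable (S \<Otimes>\<^sub>M borel)"
  shows "integrable M (\<lambda>\<omega>. g (x i \<omega>, y i \<omega>)) \<longleftrightarrow> integrable M (\<lambda>\<omega>. g (x0 \<omega>, f (x0 \<omega>) + eps \<omega>))"
    and "expectation (\<lambda>\<omega>. g (x i \<omega>, y i \<omega>)) = expectation (\<lambda>\<omega>. g (x0 \<omega>, f (x0 \<omega>) + eps \<omega>))"
  using integrable_distr_eq[OF observation_measurable assms(2)]
    integrable_distr_eq[OF generic_observation_measurable assms(2)]
    integral_distr[OF observation_measurable assms(2)]
    integral_distr[OF generic_observation_measurable assms(2)]
    sample_distr assms(1) by auto

lemma signal_integrable:
  "integrable M (\<lambda>\<omega>. (f (x0 \<omega>))\<^sup>2)" "integrable M (\<lambda>\<omega>. f (x0 \<omega>))"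
proof -
  have meas: "(\<lambda>\<omega>. f (x0 \<omega>)) \<in> borel_measurable M"
    using f_measurable x0_measurable by measurable
  show sq: "integrable M (\<lambda>\<omega>. (f (x0 \<omega>))\<^sup>2)"
    using meas signal_fourth by (subst square_integrable_imp_integrable) (simp_all add: power4_eq_xxxx power2_eq_square mult.assoc)
  show "integrable M (\<lambda>\<omega>. f (x0 \<omega>))"
    using meas sq by (rule square_integrable_imp_integrable)
qed

text \<open>The noise is centred even conditionally on the covariate. The hypothesis on independence is about
generated sigma-algebras; an indicator of the covariate is a real random variable measurable with
respect to the first of them, to which the product rule for expectations applies.\<close>

lemma noise_mean_indicator:
  assumes "B \<in> sets S"
  shows "integrable M (\<lambda>\<omega>. indicator B (x0 \<omega>) * eps \<omega>)"
    and "expectation (\<lambda>\<omega>. indicator B (x0 \<omega>) * eps \<omega>) = 0"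
proof -
  let ?X = "\<lambda>\<omega>. indicator B (x0 \<omega>) :: real"
  have X: "?X \<in> borel_measurable M"
    using x0_measurable assms by measurable
  have "?X \<in> borel_measurable (vimage_algebra (space M) x0 S)"
    using assms measurable_space[OF x0_measurable]
    by (auto intro!: measurable_compose[OF measurable_vimage_algebra1, of x0 _ S])
  then have sub: "{?X -` A \<inter> space M |A. A \<in> sets borel} \<subseteq> sets (vimage_algebra (space M) x0 S)"
    using measurable_sets[of ?X "vimage_algebra (space M) x0 S" borel] by auto
  have "indep_var borel ?X borel eps"
    unfolding indep_var_eq
  proof (intro conjI X eps_measurable)
    have "sigma_sets (space M) {?X -` A \<inter> space M |A. A \<in> sets borel} \<subseteq> sets (vimage_algebra (space M) x0 S)"
      using sets.sigma_sets_subset[OF sub] by simp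
    with noise_indep show "indep_set (sigma_sets (space M) {?X -` A \<inter> space M |A. A \<in> sets borel})
      (sigma_sets (space M) {eps -` A \<inter> space M |A. A \<in> sets borel})"
      unfolding indep_sets2_eq sets_vimage_algebra by blast
  qed
  moreover have "integrable M ?X"
    using X by (intro integrable_const_bound[where B=1]) (auto simp: indicator_def)
  moreover have "integrable M eps"
    using eps_measurable noise_integrable by (rule square_integrable_imp_integrable)
  ultimately show "integrable M (\<lambda>\<omega>. ?X \<omega> * eps \<omega>)" "expectation (\<lambda>\<omega>. ?X \<omega> * eps \<omega>) = 0"
    by (auto simp: indep_var_integrable indep_var_lebesgue_integral noise_mean)
qed

lemma y_integrable: "i \<in> {1..n} \<Longrightarrow> integrable M (y i)"
  and y_mean: "i \<in> {1..n} \<Longrightarrow> expectation (y i) = 0"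
proof -
  assume i: "i \<in> {1..n}"
  have eps: "integrable M eps"
    using eps_measurable noise_integrable by (rule square_integrable_imp_integrable)
  show "integrable M (y i)" "expectation (y i) = 0"
    using observation_integral[OF i, of snd] signal_integrable eps
    by (auto simp: signal_mean noise_mean)
qed

lemma signal_at_observation:
  assumes "i \<in> {1..n}"
  shows "(\<lambda>\<omega>. f (x i \<omega>)) \<in> borel_measurable M"
    and "integrable M (\<lambda>\<omega>. f (x i \<omega>))"
    and "integrable M (\<lambda>\<omega>. (f (x i \<omega>))\<^sup>2)"
    and "expectation (\<lambda>\<omega>. (f (x i \<omega>))\<^sup>2) = \<sigma>\<^sub>\<mu>\<^sup>2"
    and "integrable M (\<lambda>\<omega>. ((f (x i \<omega>))\<^sup>2 - \<sigma>\<^sub>\<mu>\<^sup>2)\<^sup>2)"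
    and "expectation (\<lambda>\<omega>. ((f (x i \<omega>))\<^sup>2 - \<sigma>\<^sub>\<mu>\<^sup>2)\<^sup>2) \<le> \<kappa> * \<sigma>\<^sub>\<mu> ^ 4"
proof -
  have [measurable]: "f \<in> borel_measurable S" by (rule f_measurable)
  show "(\<lambda>\<omega>. f (x i \<omega>)) \<in> borel_measurable M"
    using x_measurable[OF assms] by measurable
  show "integrable M (\<lambda>\<omega>. f (x i \<omega>))"
    using observation_integral(1)[OF assms, of "\<lambda>p. f (fst p)"] signal_integrable by simp
  show "integrable M (\<lambda>\<omega>. (f (x i \<omega>))\<^sup>2)" "expectation (\<lambda>\<omega>. (f (x i \<omega>))\<^sup>2) = \<sigma>\<^sub>\<mu>\<^sup>2"
    using observation_integral[OF assms, of "\<lambda>p. (f (fst p))\<^sup>2"] signal_integrable signal_second by simp_all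
  have "integrable M (\<lambda>\<omega>. ((f (x0 \<omega>))\<^sup>2 - \<sigma>\<^sub>\<mu>\<^sup>2)\<^sup>2)"
    using signal_fourth signal_integrable by (auto simp: power2_diff simp flip: power_mult)
  then show "integrable M (\<lambda>\<omega>. ((f (x i \<omega>))\<^sup>2 - \<sigma>\<^sub>\<mu>\<^sup>2)\<^sup>2)"
    "expectation (\<lambda>\<omega>. ((f (x i \<omega>))\<^sup>2 - \<sigma>\<^sub>\<mu>\<^sup>2)\<^sup>2) \<le> \<kappa> * \<sigma>\<^sub>\<mu> ^ 4"
    using observation_integral[OF assms, of "\<lambda>p. ((f (fst p))\<^sup>2 - \<sigma>\<^sub>\<mu>\<^sup>2)\<^sup>2"] signal_var signal_second
    by simp_all
qed

text \<open>Permuting the responses destroys the regression function except at fixed points. If \<open>\<pi> i = i\<close>, the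
noise averages out on every event of the sigma-algebra of \<open>x i\<close>. If \<open>\<pi> i \<noteq> i\<close>, the response
\<open>y (\<pi> i)\<close> is centred and independent of \<open>x i\<close>, hence has mean zero on every such event.\<close>

lemma f_perm_AE:
  assumes "i \<in> {1..n}" "\<pi> i \<in> {1..n}"
  shows "AE \<omega> in M. f_perm M S x y \<pi> i \<omega> = (if \<pi> i = i then f (x i \<omega>) else 0)"
proof -
  let ?F = "vimage_algebra (space M) (x i) S"
  let ?g = "\<lambda>\<omega>. if \<pi> i = i then f (x i \<omega>) else 0"
  have space: "x i \<in> space M \<rightarrow> space S"
    using measurable_space[OF x_measurable[OF assms(1)]] by auto
  interpret F: finite_measure_subalgebra M ?F
    using x_measurable[OF assms(1)]
    by unfold_locales (auto simp: subalgebra_def sets_vimage_algebra2[OF space] dest: measurable_sets)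
  have g: "?g \<in> borel_measurable ?F"
    using measurable_compose[OF measurable_vimage_algebra1[OF space] f_measurable] by simp
  have "AE \<omega> in M. real_cond_exp M ?F (y (\<pi> i)) \<omega> = ?g \<omega>"
  proof (rule F.real_cond_exp_charact[OF _ y_integrable[OF assms(2)] _ g])
    show "integrable M ?g" using signal_at_observation(2)[OF assms(1)] by (cases "\<pi> i = i") simp_all
    fix A assume "A \<in> sets ?F"
    then obtain B where B: "B \<in> sets S" "A = x i -` B \<inter> space M"
      by (auto simp: sets_vimage_algebra2[OF space])
    have ind: "set_lebesgue_integral M A u = expectation (\<lambda>\<omega>. indicator B (x i \<omega>) * u \<omega>)" for u :: "'w \<Rightarrow> real"
      unfolding set_lebesgue_integral_def B
      by (intro Bochner_Integration.integral_cong) (auto simp: indicator_def)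
    have [measurable]: "f \<in> borel_measurable S" "B \<in> sets S" "x0 \<in> M \<rightarrow>\<^sub>M S"
      using f_measurable B x0_measurable by auto
    show "(\<integral>\<omega>\<in>A. y (\<pi> i) \<omega> \<partial>M) = (\<integral>\<omega>\<in>A. ?g \<omega> \<partial>M)"
    proof (cases "\<pi> i = i")
      case True
      have int: "integrable M (\<lambda>\<omega>. indicator B (x0 \<omega>) * f (x0 \<omega>))"
        by (rule Bochner_Integration.integrable_bound[OF signal_integrable(2)]) (auto simp: indicator_def)
      have "expectation (\<lambda>\<omega>. indicator B (x i \<omega>) * y i \<omega>)
          = expectation (\<lambda>\<omega>. indicator B (x0 \<omega>) * (f (x0 \<omega>) + eps \<omega>))"
        using observation_integral(2)[OF assms(1), of "\<lambda>p. indicator B (fst p) * snd p"] by simp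
      also have "\<dots> = expectation (\<lambda>\<omega>. indicator B (x0 \<omega>) * f (x0 \<omega>))
          + expectation (\<lambda>\<omega>. indicator B (x0 \<omega>) * eps \<omega>)"
        unfolding distrib_left using noise_mean_indicator[OF B(1)] int by simp
      also have "\<dots> = expectation (\<lambda>\<omega>. indicator B (x i \<omega>) * f (x i \<omega>))"
        using observation_integral(2)[OF assms(1), of "\<lambda>p. indicator B (fst p) * f (fst p)"]
          noise_mean_indicator[OF B(1)] by simp
      finally show ?thesis using True by (simp add: ind)
    next
      case False
      \<comment> \<open>One family of functions of the observations whose members at \<open>i\<close> and \<open>\<pi> i\<close> are the
        indicator of \<open>x i \<in> B\<close> and the response \<open>y (\<pi> i)\<close>.\<close>
      define Y where "Y k p = (if k = i then indicator B (fst p) else snd p :: real)" for k :: nat and p :: "'a \<times> real"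
      define W where "W k \<omega> = Y k (x k \<omega>, y k \<omega>)" for k \<omega>
      have Y: "Y k \<in> borel_measurable (S \<Otimes>\<^sub>M borel)" for k
        unfolding Y_def by measurable
      have "indep_vars (\<lambda>_. borel) W {i, \<pi> i}"
        unfolding W_def by (rule indep_vars_compose2[OF indep_vars_subset[OF sample_indep] Y]) (use assms in auto)
      moreover have "integrable M (W i)"
      proof (rule integrable_const_bound[where B=1])
        show "W i \<in> borel_measurable M"
          unfolding W_def by (rule measurable_compose[OF observation_measurable[OF assms(1)] Y])
      qed (auto simp: W_def Y_def indicator_def)
      moreover have "W (\<pi> i) = y (\<pi> i)" using False by (auto simp: W_def Y_def)
      ultimately have "expectation (\<lambda>\<omega>. W i \<omega> * W (\<pi> i) \<omega>) = 0"
        using expectation_mult_indep_vars(2)[of W i "\<pi> i"] y_integrable[OF assms(2)] y_mean[OF assms(2)] False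
        by auto
      then show ?thesis using False by (simp add: ind) (simp add: W_def Y_def)
    qed
  qed
  then show ?thesis by (simp add: f_perm_def)
qed

text \<open>Chebyshev's inequality. The energy has mean \<open>n\<close> times the signal strength, and the bound \<open>\<kappa>\<close> on the
relative variance of the squared signal makes its standard deviation at most of order
\<open>sqrt n\<close> times the signal strength.\<close>

lemma prob_signal_energy_small:
  assumes "1 \<le> n" "0 < \<sigma>\<^sub>\<mu>\<^sup>2"
  shows "prob {\<omega> \<in> space M. (\<Sum>i=1..n. (f (x i \<omega>))\<^sup>2) \<le> real n * \<sigma>\<^sub>\<mu>\<^sup>2 / 2} \<le> 4 * \<kappa> / real n"
proof -
  let ?W = "\<lambda>i \<omega>. (f (x i \<omega>))\<^sup>2 - \<sigma>\<^sub>\<mu>\<^sup>2"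
  let ?c = "(real n * \<sigma>\<^sub>\<mu>\<^sup>2 / 2)\<^sup>2"
  have [measurable]: "(\<lambda>\<omega>. f (x i \<omega>)) \<in> borel_measurable M" if "i \<in> {1..n}" for i
    using signal_at_observation(1)[OF that] .
  have indep: "indep_vars (\<lambda>_. borel) ?W {1..n}"
  proof -
    have "(\<lambda>p. (f (fst p))\<^sup>2 - \<sigma>\<^sub>\<mu>\<^sup>2) \<in> borel_measurable (S \<Otimes>\<^sub>M borel)"
      using f_measurable by measurable
    from indep_vars_compose2[OF sample_indep this] show ?thesis by simp
  qed
  have mean: "expectation (?W i) = 0" if "i \<in> {1..n}" for i
    using signal_at_observation[OF that] by (simp add: prob_space)
  note moment = second_moment_sum_indep[OF finite_atLeastAtMost indep signal_at_observation(5) mean]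
  have "(real n * \<sigma>\<^sub>\<mu>\<^sup>2 / 2)\<^sup>2 \<le> (\<Sum>i=1..n. ?W i \<omega>)\<^sup>2"
    if "(\<Sum>i=1..n. (f (x i \<omega>))\<^sup>2) \<le> real n * \<sigma>\<^sub>\<mu>\<^sup>2 / 2" for \<omega>
  proof -
    have "real n * \<sigma>\<^sub>\<mu>\<^sup>2 / 2 \<le> - (\<Sum>i=1..n. ?W i \<omega>)"
      using that by (simp add: sum_subtractf)
    then have "(real n * \<sigma>\<^sub>\<mu>\<^sup>2 / 2)\<^sup>2 \<le> (- (\<Sum>i=1..n. ?W i \<omega>))\<^sup>2"
      by (intro power_mono) auto
    then show ?thesis by simp
  qed
  then have "prob {\<omega> \<in> space M. (\<Sum>i=1..n. (f (x i \<omega>))\<^sup>2) \<le> real n * \<sigma>\<^sub>\<mu>\<^sup>2 / 2}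
      \<le> prob {\<omega> \<in> space M. ?c \<le> (\<Sum>i=1..n. ?W i \<omega>)\<^sup>2}"
    by (intro finite_measure_mono) auto
  also have "\<dots> \<le> expectation (\<lambda>\<omega>. (\<Sum>i=1..n. ?W i \<omega>)\<^sup>2) / ?c"
    using moment(1) assms by (intro integral_Markov_inequality_measure[where A="{}"]) auto
  also have "\<dots> = (\<Sum>i=1..n. expectation (\<lambda>\<omega>. (?W i \<omega>)\<^sup>2)) / ?c"
    by (subst moment(2)) simp_all
  also have "\<dots> \<le> (\<Sum>i=1..n. \<kappa> * \<sigma>\<^sub>\<mu> ^ 4) / ?c"
    by (intro divide_right_mono sum_mono signal_at_observation(6)) auto
  also have "\<dots> = 4 * \<kappa> / real n"
  proof -
    have "\<sigma>\<^sub>\<mu> \<noteq> 0" using assms(2) by auto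
    then show ?thesis using assms(1) by (simp add: field_simps power2_eq_square power4_eq_xxxx)
  qed
  finally show ?thesis .
qed

text \<open>Markov's inequality for the part of the energy carried by a small set of observations. It is used
for the fixed points of a permutation, where the permuted regression function does not vanish.\<close>

lemma prob_partial_energy_large:
  assumes "J \<subseteq> {1..n}" "0 < l"
  shows "prob {\<omega> \<in> space M. l \<le> (\<Sum>i\<in>J. (f (x i \<omega>))\<^sup>2)} \<le> real (card J) * \<sigma>\<^sub>\<mu>\<^sup>2 / l"
proof -
  have J: "i \<in> {1..n}" if "i \<in> J" for i using assms that by auto
  have "integrable M (\<lambda>\<omega>. \<Sum>i\<in>J. (f (x i \<omega>))\<^sup>2)"
    using signal_at_observation(3) J by (intro Bochner_Integration.integrable_sum) auto
  then have "prob {\<omega> \<in> space M. l \<le> (\<Sum>i\<in>J. (f (x i \<omega>))\<^sup>2)} \<le> expectation (\<lambda>\<omega>. \<Sum>i\<in>J. (f (x i \<omega>))\<^sup>2) / l"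
    using assms by (intro integral_Markov_inequality_measure[where A="{}"]) (auto simp: sum_nonneg)
  also have "expectation (\<lambda>\<omega>. \<Sum>i\<in>J. (f (x i \<omega>))\<^sup>2) = (\<Sum>i\<in>J. \<sigma>\<^sub>\<mu>\<^sup>2)"
    using signal_at_observation(3,4) J by (subst Bochner_Integration.integral_sum) (auto intro!: sum.cong)
  finally show ?thesis by simp
qed

end

section \<open>Comparison of the test statistics\<close>

text \<open>The triangle inequality in Euclidean space. The vector \<open>u\<close> is within \<open>sqrt l\<close> of a vector of length
at least \<open>3 * sqrt l\<close>, and \<open>v\<close> is within \<open>sqrt l\<close> of a vector of length below \<open>sqrt l\<close>, so the value \<open>2 * sqrt l\<close>
separates their lengths.\<close>

lemma sum_sq_less_if_approx:
  fixes u v g g' :: "'i \<Rightarrow> real"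
  assumes "(\<Sum>i\<in>I. (u i - g i)\<^sup>2) \<le> l" "(\<Sum>i\<in>I. (v i - g' i)\<^sup>2) \<le> l"
    and "9 * l \<le> (\<Sum>i\<in>I. (g i)\<^sup>2)" "(\<Sum>i\<in>I. (g' i)\<^sup>2) < l"
  shows "(\<Sum>i\<in>I. (v i)\<^sup>2) < (\<Sum>i\<in>I. (u i)\<^sup>2)"
proof -
  have "L2_set v I \<le> L2_set g' I + L2_set (\<lambda>i. v i - g' i) I"
    using L2_set_triangle_ineq[of g' "\<lambda>i. v i - g' i" I] by simp
  moreover have "L2_set g' I < sqrt l" "L2_set (\<lambda>i. v i - g' i) I \<le> sqrt l"
    using assms by (auto simp: L2_set_def)
  moreover have "L2_set g I \<le> L2_set u I + L2_set (\<lambda>i. g i - u i) I"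
    using L2_set_triangle_ineq[of u "\<lambda>i. g i - u i" I] by simp
  moreover have "L2_set (\<lambda>i. g i - u i) I \<le> sqrt l"
    using assms(1) by (simp add: L2_set_def power2_commute)
  moreover have "3 * sqrt l \<le> L2_set g I"
  proof -
    have "3 * sqrt l = sqrt (9 * l)" by (simp add: real_sqrt_mult)
    then show ?thesis using assms(3) by (simp add: L2_set_def)
  qed
  ultimately have "L2_set v I < L2_set u I" by linarith
  then show ?thesis by (simp add: L2_set_def)
qed

definition fit_event :: "'w measure \<Rightarrow> 'a measure \<Rightarrow> 'a estimator \<Rightarrow> nat \<Rightarrow>
    (nat \<Rightarrow> 'w \<Rightarrow> 'a) \<Rightarrow> (nat \<Rightarrow> 'w \<Rightarrow> real) \<Rightarrow> real \<Rightarrow> (nat \<Rightarrow> nat) \<Rightarrow> 'w set" where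
  "fit_event M S fhat n x y l \<pi> = {\<omega> \<in> space M.
     (\<Sum>i=1..n. (fhat n (x i \<omega>) (sample n (\<lambda>j. x j \<omega>) (\<lambda>j. y j \<omega>)) \<pi>
        - f_perm M S x y \<pi> i \<omega>)\<^sup>2) \<le> l}"

definition exceed_event :: "'w measure \<Rightarrow> 'a estimator \<Rightarrow> nat \<Rightarrow>
    (nat \<Rightarrow> 'w \<Rightarrow> 'a) \<Rightarrow> (nat \<Rightarrow> 'w \<Rightarrow> real) \<Rightarrow> (nat \<Rightarrow> nat) \<Rightarrow> 'w set" where
  "exceed_event M fhat n x y \<pi> = {\<omega> \<in> space M.
     test_stat fhat n (\<lambda>j. x j \<omega>) (\<lambda>j. y j \<omega>) id \<le> test_stat fhat n (\<lambda>j. x j \<omega>) (\<lambda>j. y j \<omega>) \<pi>}"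

context regression_sample
begin

lemma test_stat_measurable:
  assumes "measurable_estimator S fhat" "\<pi> \<in> perms n"
  shows "(\<lambda>\<omega>. test_stat fhat n (\<lambda>j. x j \<omega>) (\<lambda>j. y j \<omega>) \<pi>) \<in> borel_measurable M"
proof -
  have sample: "(\<lambda>\<omega>. sample n (\<lambda>j. x j \<omega>) (\<lambda>j. y j \<omega>)) \<in> M \<rightarrow>\<^sub>M (\<Pi>\<^sub>M j\<in>{1..n}. S \<Otimes>\<^sub>M borel)"
    unfolding sample_def using observation_measurable by (intro measurable_restrict)
  have "(\<lambda>\<omega>. fhat n (x i \<omega>) (sample n (\<lambda>j. x j \<omega>) (\<lambda>j. y j \<omega>)) \<pi>) \<in> borel_measurable M"
    if "i \<in> {1..n}" for i
  proof -
    have fhat: "(\<lambda>(u, d). fhat n u d \<pi>) \<in> borel_measurable (S \<Otimes>\<^sub>M (\<Pi>\<^sub>M j\<in>{1..n}. S \<Otimes>\<^sub>M borel))"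
      using assms by (auto simp: measurable_estimator_def)
    show ?thesis
      using measurable_compose[OF measurable_Pair[OF x_measurable[OF that] sample] fhat] by simp
  qed
  then show ?thesis unfolding test_stat_def by measurable
qed

text \<open>Suppose that the estimator is accurate for the data and for the permuted data, and that the signal
has at least half of its mean energy, with energy below \<open>l\<close> at the fixed points of the permutation.
Since \<open>h \<ge> 18\<close>, half of the mean energy is at least \<open>9 * l\<close>, and \<open>sum_sq_less_if_approx\<close> shows that
the permuted statistic is the smaller one. The bound adds the probabilities of the four ways in
which this can fail.\<close>

lemma prob_exceed_event_le:
  assumes "\<pi> \<in> perms n" "1 \<le> n" "0 < l" "18 \<le> h" and signal: "\<sigma>\<^sub>\<mu>\<^sup>2 = h * l / real n"
    and "0 < \<delta>" "\<delta> < 1"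
    and fit_id: "1 - \<delta> \<le> prob (fit_event M S fhat n x y l id)"
    and fit_pi: "1 - \<delta> \<le> prob (fit_event M S fhat n x y l \<pi>)"
  shows "prob (exceed_event M fhat n x y \<pi>)
    \<le> 2 * \<delta> + 4 * \<kappa> / real n + h * real (card {i \<in> {1..n}. \<pi> i = i}) / real n"
proof -
  let ?J = "{i \<in> {1..n}. \<pi> i = i}"
  let ?A = "fit_event M S fhat n x y l"
  let ?C = "{\<omega> \<in> space M. (\<Sum>i=1..n. (f (x i \<omega>))\<^sup>2) \<le> real n * \<sigma>\<^sub>\<mu>\<^sup>2 / 2}"
  let ?D = "{\<omega> \<in> space M. l \<le> (\<Sum>i\<in>?J. (f (x i \<omega>))\<^sup>2)}"
  have [measurable]: "(\<lambda>\<omega>. f (x i \<omega>)) \<in> borel_measurable M" if "i \<in> {1..n}" for i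
    using signal_at_observation(1)[OF that] .
  \<comment> \<open>A set outside the sigma-algebra would have measure \<open>0 < 1 - \<delta>\<close>.\<close>
  have A: "?A id \<in> events" "?A \<pi> \<in> events"
    using fit_id fit_pi assms(6,7) measure_notin_sets by fastforce+
  have C: "?C \<in> events" by measurable
  have D: "?D \<in> events" by measurable
  have fp: "AE \<omega> in M. \<forall>i\<in>{1..n}. f_perm M S x y \<rho> i \<omega> = (if \<rho> i = i then f (x i \<omega>) else 0)"
    if "\<rho> permutes {1..n}" for \<rho>
    using f_perm_AE permutes_in_image[OF that] by (intro AE_finite_allI) auto
  have "id permutes {1..n}" "\<pi> permutes {1..n}"
    using assms(1) by (auto simp: perms_def permutes_id)
  from fp[OF this(1)] fp[OF this(2)]
  have "AE \<omega> in M. \<omega> \<in> exceed_event M fhat n x y \<pi> \<longrightarrow>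
      \<omega> \<in> (space M - ?A id) \<union> (space M - ?A \<pi>) \<union> ?C \<union> ?D"
  proof eventually_elim
    case (elim \<omega>)
    show ?case
    proof (rule impI, rule ccontr)
      let ?u = "\<lambda>\<rho> i. fhat n (x i \<omega>) (sample n (\<lambda>j. x j \<omega>) (\<lambda>j. y j \<omega>)) \<rho>"
      assume E: "\<omega> \<in> exceed_event M fhat n x y \<pi>"
        and "\<omega> \<notin> (space M - ?A id) \<union> (space M - ?A \<pi>) \<union> ?C \<union> ?D"
      then have \<omega>: "\<omega> \<in> ?A id" "\<omega> \<in> ?A \<pi>" "\<omega> \<notin> ?C" "\<omega> \<notin> ?D" "\<omega> \<in> space M"
        by (auto simp: exceed_event_def)
      have "(\<Sum>i=1..n. (?u id i - f (x i \<omega>))\<^sup>2) \<le> l"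
        using \<omega>(1) elim(1) by (simp add: fit_event_def)
      moreover have "(\<Sum>i=1..n. (?u \<pi> i - (if \<pi> i = i then f (x i \<omega>) else 0))\<^sup>2) \<le> l"
        using \<omega>(2) elim(2) by (simp add: fit_event_def)
      moreover have "9 * l \<le> (\<Sum>i=1..n. (f (x i \<omega>))\<^sup>2)"
      proof -
        have "18 * l \<le> h * l" using assms by (intro mult_right_mono) auto
        then have "9 * l \<le> real n * \<sigma>\<^sub>\<mu>\<^sup>2 / 2" using assms by simp
        then show ?thesis using \<omega> by auto
      qed
      moreover have "(\<Sum>i=1..n. (if \<pi> i = i then f (x i \<omega>) else 0)\<^sup>2) < l"
      proof -
        have "(\<Sum>i=1..n. (if \<pi> i = i then f (x i \<omega>) else 0)\<^sup>2) = (\<Sum>i\<in>?J. (f (x i \<omega>))\<^sup>2)"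
          by (rule sum.mono_neutral_cong_right) auto
        then show ?thesis using \<omega>(4,5) by auto
      qed
      ultimately have "(\<Sum>i=1..n. (?u \<pi> i)\<^sup>2) < (\<Sum>i=1..n. (?u id i)\<^sup>2)"
        by (rule sum_sq_less_if_approx)
      with E show False by (simp add: exceed_event_def test_stat_def)
    qed
  qed
  then have "prob (exceed_event M fhat n x y \<pi>) \<le> prob ((space M - ?A id) \<union> (space M - ?A \<pi>) \<union> ?C \<union> ?D)"
    using A C D by (intro finite_measure_mono_AE) auto
  also have "\<dots> \<le> prob (space M - ?A id) + prob (space M - ?A \<pi>) + prob ?C + prob ?D"
  proof -
    have ev: "space M - ?A id \<in> events" "space M - ?A \<pi> \<in> events" using A by auto
    show ?thesis
      using measure_Un_le[OF sets.Un[OF sets.Un[OF ev] C] D] measure_Un_le[OF sets.Un[OF ev] C]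
        measure_Un_le[OF ev] by linarith
  qed
  also have "\<dots> \<le> \<delta> + \<delta> + 4 * \<kappa> / real n + real (card ?J) * \<sigma>\<^sub>\<mu>\<^sup>2 / l"
    using prob_compl[OF A(1)] prob_compl[OF A(2)] fit_id fit_pi assms
    by (intro add_mono prob_signal_energy_small prob_partial_energy_large) auto
  finally show ?thesis using assms by (simp add: field_simps)
qed

text \<open>By linearity the mean of the p-value is the average over all permutations of the probability that
the permuted statistic is at least the original one. Permutations with many cycles contribute at
most their proportion; for the others \<open>prob_exceed_event_le\<close> applies. Markov's inequality turns
the bound on the mean into a bound on the probability that the p-value is large.\<close>

lemma pvalue_tail_bound:
  assumes meas: "measurable_estimator S fhat" and "2 \<le> n" "0 < l" "18 \<le> h"
    and "\<sigma>\<^sub>\<mu>\<^sup>2 = h * l / real n" "0 < \<delta>" "\<delta> < 1" "0 < \<kappa>" "0 < \<alpha>"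
    and fit: "\<And>\<pi>. \<pi> \<in> few_cycle_perms n \<union> {id} \<Longrightarrow> 1 - \<delta> \<le> prob (fit_event M S fhat n x y l \<pi>)"
  defines "r \<equiv> 4 * \<kappa> / real n + h * (ln (real n))\<^sup>2 / real n + (ln (real n) + 1) / (ln (real n))\<^sup>2"
  shows "1 - (2 * \<delta> + r) / \<alpha> \<le>
    prob {\<omega> \<in> space M. perm_pvalue fhat n (\<lambda>j. x j \<omega>) (\<lambda>j. y j \<omega>) \<le> \<alpha>}"
proof -
  let ?p = "\<lambda>\<omega>. perm_pvalue fhat n (\<lambda>j. x j \<omega>) (\<lambda>j. y j \<omega>)"
  let ?E = "exceed_event M fhat n x y"
  let ?b = "2 * \<delta> + 4 * \<kappa> / real n + h * (ln (real n))\<^sup>2 / real n"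
  have id: "id \<in> perms n" by (simp add: perms_def permutes_id)
  have E: "?E \<pi> \<in> events" if "\<pi> \<in> perms n" for \<pi>
    unfolding exceed_event_def
    using test_stat_measurable[OF meas that] test_stat_measurable[OF meas id] by measurable
  have p: "?p \<omega> = (\<Sum>\<pi>\<in>perms n. indicator (?E \<pi>) \<omega>) / fact n" if "\<omega> \<in> space M" for \<omega>
    using that by (auto simp: perm_pvalue_def exceed_event_def indicator_def of_bool_def intro!: sum.cong)
  have int: "integrable M (\<lambda>\<omega>. \<Sum>\<pi>\<in>perms n. indicator (?E \<pi>) \<omega> :: real)"
    using E by (intro Bochner_Integration.integrable_sum) (auto simp: integrable_indicator_iff less_top[symmetric])
  have int_p: "integrable M ?p"
    using integrable_divide_zero[of "fact n", OF int]
    by (subst Bochner_Integration.integrable_cong[OF refl p]) auto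
  have mean_eq: "expectation ?p = (\<Sum>\<pi>\<in>perms n. prob (?E \<pi>)) / fact n"
  proof -
    have "expectation ?p = expectation (\<lambda>\<omega>. \<Sum>\<pi>\<in>perms n. indicator (?E \<pi>) \<omega>) / fact n"
      by (subst Bochner_Integration.integral_cong[OF refl p]) auto
    also have "expectation (\<lambda>\<omega>. \<Sum>\<pi>\<in>perms n. indicator (?E \<pi>) \<omega>) = (\<Sum>\<pi>\<in>perms n. prob (?E \<pi>))"
      using E by (subst Bochner_Integration.integral_sum)
        (auto simp: integrable_indicator_iff less_top[symmetric] intro!: sum.cong)
    finally show ?thesis .
  qed
  have "(\<Sum>\<pi>\<in>perms n. prob (?E \<pi>)) =
      (\<Sum>\<pi>\<in>perms n - few_cycle_perms n. prob (?E \<pi>)) + (\<Sum>\<pi>\<in>few_cycle_perms n. prob (?E \<pi>))"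
    by (rule sum.subset_diff) (auto simp: few_cycle_perms_def)
  also have "\<dots> \<le> (\<Sum>\<pi>\<in>perms n - few_cycle_perms n. 1) + (\<Sum>\<pi>\<in>few_cycle_perms n. ?b)"
  proof (intro add_mono sum_mono)
    fix \<pi> assume \<pi>: "\<pi> \<in> few_cycle_perms n"
    have "real (card {i \<in> {1..n}. \<pi> i = i}) \<le> (ln (real n))\<^sup>2"
      using card_fixed_points_le_num_cycles[of n \<pi>] \<pi> by (simp add: few_cycle_perms_def)
    then have "h * real (card {i \<in> {1..n}. \<pi> i = i}) / real n \<le> h * (ln (real n))\<^sup>2 / real n"
      using assms by (intro divide_right_mono mult_left_mono) auto
    then show "prob (?E \<pi>) \<le> ?b"
      using prob_exceed_event_le[of \<pi> l h \<delta> fhat] \<pi> assms fit by (auto simp: few_cycle_perms_def)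
  qed simp
  also have "\<dots> \<le> fact n * ((ln (real n) + 1) / (ln (real n))\<^sup>2) + fact n * ?b"
  proof (intro add_mono)
    have "card (few_cycle_perms n) \<le> card (perms n)"
      by (intro card_mono) (auto simp: few_cycle_perms_def)
    then have "real (card (few_cycle_perms n)) \<le> fact n"
      by (metis card_perms of_nat_fact of_nat_le_iff)
    then show "(\<Sum>\<pi>\<in>few_cycle_perms n. ?b) \<le> fact n * ?b"
      using assms by (simp add: mult_right_mono)
  qed (use card_many_cycle_perms_le[OF assms(2)] in simp)
  also have "\<dots> = fact n * (2 * \<delta> + r)" by (simp add: r_def algebra_simps)
  finally have mean: "expectation ?p \<le> 2 * \<delta> + r"
    unfolding mean_eq by (simp add: pos_divide_le_eq mult.commute)
  have "prob {\<omega> \<in> space M. \<alpha> \<le> ?p \<omega>} \<le> expectation ?p / \<alpha>"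
    using int_p assms(9)
    by (intro integral_Markov_inequality_measure[where A="{}"]) (auto simp: perm_pvalue_def sum_nonneg)
  also have "\<dots> \<le> (2 * \<delta> + r) / \<alpha>" using mean assms(9) by (intro divide_right_mono) auto
  finally have tail: "prob {\<omega> \<in> space M. \<alpha> \<le> ?p \<omega>} \<le> (2 * \<delta> + r) / \<alpha>" .
  have [measurable]: "?p \<in> borel_measurable M" using int_p by auto
  have "1 - prob {\<omega> \<in> space M. \<alpha> \<le> ?p \<omega>} = prob (space M - {\<omega> \<in> space M. \<alpha> \<le> ?p \<omega>})"
    by (rule prob_compl[symmetric]) measurable
  also have "\<dots> \<le> prob {\<omega> \<in> space M. ?p \<omega> \<le> \<alpha>}"
    by (intro finite_measure_mono) auto
  finally show ?thesis using tail by linarith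
qed

end

section \<open>Power of the permutation test\<close>

theorem corollary4p1:
  fixes \<alpha> \<delta> \<kappa> :: real
    and S :: "'a measure"
    and \<F> :: "('a \<Rightarrow> real) set"
    and fhat :: "'a estimator"
    and \<l> :: "nat \<Rightarrow> real"
  assumes "0 < \<alpha>" "\<alpha> < 1"
    and "0 < \<delta>" "\<delta> < \<alpha> * (1 - \<alpha>) / 4"
    and "0 < \<kappa>"
    and "measurable_estimator S fhat"
    and "\<And>n \<pi> i (x :: nat \<Rightarrow> 'a) (y :: nat \<Rightarrow> real).
      \<pi> \<in> perms n \<Longrightarrow> i \<in> {1..n} \<Longrightarrow> (\<And>j. j \<in> {1..n} \<Longrightarrow> x j \<in> space S) \<Longrightarrow>
      fhat n (x i) (sample n x y) \<pi> = fhat n (x i) (sample n x (y \<circ> \<pi>)) id"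
  shows "\<exists>h\<^sub>0>0. \<forall>h\<ge>h\<^sub>0.
    \<forall>(M :: nat \<Rightarrow> 'w measure) f x0 eps x y \<sigma>\<^sub>\<mu> \<sigma>\<^sub>\<epsilon>.
      (\<forall>n\<ge>1. regression_sample (M n) S n (f n) (x0 n) (eps n) (x n) (y n) (\<sigma>\<^sub>\<mu> n) (\<sigma>\<^sub>\<epsilon> n) \<kappa>) \<longrightarrow>
      (\<forall>\<^sub>F n in sequentially.
        (MIN \<pi>\<in>few_cycle_perms n \<union> {id}.
          measure (M n) {\<omega> \<in> space (M n).
            (\<Sum>i=1..n. (fhat n (x n i \<omega>) (sample n (\<lambda>j. x n j \<omega>) (\<lambda>j. y n j \<omega>)) \<pi>
               - f_perm (M n) S (x n) (y n) \<pi> i \<omega>)\<^sup>2) \<le> \<l> n}) \<ge> 1 - \<delta>) \<longrightarrow>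
      (\<forall>n\<ge>1. alternative \<F> h (\<l> n) n (M n) (f n) (x0 n) (\<sigma>\<^sub>\<mu> n)) \<longrightarrow>
      liminf (\<lambda>n. ereal (measure (M n) {\<omega> \<in> space (M n).
        perm_pvalue fhat n (\<lambda>j. x n j \<omega>) (\<lambda>j. y n j \<omega>) \<le> \<alpha>})) > ereal \<alpha>"
proof (intro exI[of _ "18::real"] conjI allI impI)
  fix h :: real and M :: "nat \<Rightarrow> 'w measure" and f x0 eps x y \<sigma>\<^sub>\<mu> \<sigma>\<^sub>\<epsilon>
  assume h: "18 \<le> h"
    and model: "\<forall>n\<ge>1. regression_sample (M n) S n (f n) (x0 n) (eps n) (x n) (y n) (\<sigma>\<^sub>\<mu> n) (\<sigma>\<^sub>\<epsilon> n) \<kappa>"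
    and fit: "\<forall>\<^sub>F n in sequentially.
        (MIN \<pi>\<in>few_cycle_perms n \<union> {id}.
          measure (M n) {\<omega> \<in> space (M n).
            (\<Sum>i=1..n. (fhat n (x n i \<omega>) (sample n (\<lambda>j. x n j \<omega>) (\<lambda>j. y n j \<omega>)) \<pi>
               - f_perm (M n) S (x n) (y n) \<pi> i \<omega>)\<^sup>2) \<le> \<l> n}) \<ge> 1 - \<delta>"
    and alt: "\<forall>n\<ge>1. alternative \<F> h (\<l> n) n (M n) (f n) (x0 n) (\<sigma>\<^sub>\<mu> n)"
  let ?P = "\<lambda>n. measure (M n) {\<omega> \<in> space (M n).
        perm_pvalue fhat n (\<lambda>j. x n j \<omega>) (\<lambda>j. y n j \<omega>) \<le> \<alpha>}"
  define r where "r n = 4 * \<kappa> / real n + h * (ln (real n))\<^sup>2 / real n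
    + (ln (real n) + 1) / (ln (real n))\<^sup>2" for n :: nat
  have "r \<longlonglongrightarrow> 0" unfolding r_def by real_asymp
  moreover have "0 < \<alpha> * (1 - \<alpha>) / 2 - 2 * \<delta>" using assms(4) by simp
  ultimately have "\<forall>\<^sub>F n in sequentially. r n < \<alpha> * (1 - \<alpha>) / 2 - 2 * \<delta>"
    by (rule order_tendstoD)
  with fit eventually_ge_at_top[of 2]
  have "\<forall>\<^sub>F n in sequentially. (1 + \<alpha>) / 2 \<le> ?P n"
  proof eventually_elim
    case (elim n)
    interpret regression_sample "M n" S n "f n" "x0 n" "eps n" "x n" "y n" "\<sigma>\<^sub>\<mu> n" "\<sigma>\<^sub>\<epsilon> n" \<kappa>
      using model elim by auto
    have sig: "(\<sigma>\<^sub>\<mu> n)\<^sup>2 = h * \<l> n / real n" "\<not> (AE \<omega> in M n. f n (x0 n \<omega>) = 0)"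
      using alt elim by (auto simp: alternative_def)
    \<comment> \<open>A signal that is not almost surely zero has positive strength, which forces \<open>\<l> n > 0\<close>.\<close>
    have "(\<sigma>\<^sub>\<mu> n)\<^sup>2 \<noteq> 0"
      using integral_nonneg_eq_0_iff_AE[OF signal_integrable(1)] signal_second sig(2) by auto
    then have "0 < h * \<l> n / real n" using sig(1) by (metis zero_less_power2 zero_eq_power2)
    then have l: "0 < \<l> n" using h elim by (simp add: zero_less_divide_iff zero_less_mult_iff)
    have fit': "1 - \<delta> \<le> prob (fit_event (M n) S fhat n (x n) (y n) (\<l> n) \<pi>)"
      if "\<pi> \<in> few_cycle_perms n \<union> {id}" for \<pi>
    proof -
      have "finite (few_cycle_perms n \<union> {id})"
        by (auto simp: few_cycle_perms_def)
      from Min_le[OF finite_imageI[OF this] imageI[OF that]] elim(1) show ?thesis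
        unfolding fit_event_def by (rule order_trans[rotated])
    qed
    have "\<alpha> * (1 - \<alpha>) < 1 * 1" using assms by (intro mult_strict_mono) auto
    then have "\<delta> < 1" using assms by linarith
    from pvalue_tail_bound[OF assms(6) elim(2) l h sig(1) assms(3) this assms(5,1) fit']
    have "1 - (2 * \<delta> + r n) / \<alpha> \<le> ?P n" by (simp add: r_def)
    moreover have "(2 * \<delta> + r n) / \<alpha> \<le> (1 - \<alpha>) / 2"
      using elim assms by (subst pos_divide_le_eq) (auto simp: algebra_simps)
    ultimately have "1 - (1 - \<alpha>) / 2 \<le> ?P n" by (meson diff_left_mono order_trans)
    then show ?case by (simp add: field_simps)
  qed
  then have "ereal ((1 + \<alpha>) / 2) \<le> liminf (\<lambda>n. ereal (?P n))"
    by (intro Liminf_bounded) (auto elim: eventually_mono)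
  moreover have "ereal \<alpha> < ereal ((1 + \<alpha>) / 2)" using assms by simp
  ultimately show "ereal \<alpha> < liminf (\<lambda>n. ereal (?P n))" by (rule less_le_trans[rotated])
qed simp

end
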